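(* Let $\mu_1,\mu_2:\mathcal{C}\to\mathbb{R}_0^+$ and $\nu:\mathcal{E}\to\mathbb{R}_0^+$ be set functions vanishing on the empty set, with $\mu_1\le\mu_2$ setwise, i.e. $\mu_1(E)\le\mu_2(E)$ for every $E\in\mathcal{C}$. Let $f:S\to\mathbb{R}_0^+$ be $\mu_i$-measurable for $i=1,2$, and let $A\in\mathcal{C}$ be such that $f\in G_{RL}(\nu,\mu_i,A)$ for $i=1,2$. Then $$\int_A^{*} f\,d(\nu,\mu_1)\le\int_A^{*} f\,d(\nu,\mu_2).$$
   Context: $\mathbb{R}_0^+=[0,\infty)$. $S$ is a nonempty, at least countable set, $\mathcal{C}$ is a $\sigma$-algebra of subsets of $S$, and $\mathcal{E}$ is a $\sigma$-algebra of subsets of $\mathbb{R}_0^+$ with $\{0\}\in\mathcal{E}$. Set functions on $\mathcal{C}$ and $\mathcal{E}$ have values in $\mathbb{R}_0^+$, vanish on $\emptyset$, and are not assumed additive or monotone unless stated. Below, $\mu$ denotes any such set function on $\mathcal{C}$. Measurability: $f:S\to\mathbb{R}_0^+$ is $\mu$-measurable if it is $\mathcal{C}$-measurable, i.e. $E_f^\alpha:=\{s\in S: f(s)\ge\alpha\}\in\mathcal{C}$ for all $\alpha\ge 0$. Riemann-Lebesgue (RL) integral: for two countable partitions $P,P'$ of $\mathbb{R}_0^+$, $P'$ is finer than $P$ if every set of $P'$ is included in some set of $P$. A function $g:\mathbb{R}_0^+\to\mathbb{R}$ is $\nu$-RL integrable if there is $a\in\mathbb{R}$ such that for every $\varepsilon>0$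 there is a countable partition $\Pi_\varepsilon$ of $\mathbb{R}_0^+$ into sets of $\mathcal{E}$ such that for every countable partition $\Pi=(E_n)_n$ of $\mathbb{R}_0^+$ into sets of $\mathcal{E}$ finer than $\Pi_\varepsilon$: $g$ is bounded on every $E_n$ with $\nu(E_n)>0$, and for every choice of $s_n\in E_n$ the series $\sum_n g(s_n)\nu(E_n)$ converges absolutely and $|\sum_n g(s_n)\nu(E_n)-a|<\varepsilon$. Then $a$ is unique and is denoted $(RL)\int_{[0,\infty)}g\,d\nu$. Generalized decomposition integral: for a $\mu$-measurable $f:S\to\mathbb{R}_0^+$ and $A\in\mathcal{C}$ put $u_{f,\mu}^{A}(\alpha)=\mu(E_f^\alpha\cap A)$, $\alpha\ge 0$. $f$ is $(\nu,\mu)$-integrable on $A$ if $u_{f,\mu}^A$ is $\nu$-RL integrable on $\mathbb{R}_0^+$, and then $\int_A^{*}f\,d(\nu,\mu):=(RL)\int_{[0,\infty)}u_{f,\mu}^A\,d\nu$. $G_{RL}(\nu,\mu,A)$ is the set of all $\mu$-measurable $f:S\to\mathbb{R}_0^+$ that are $(\nu,\mu)$-integrable on $A$ (with finite integral). *)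

theory Defs
  imports "HOL-Analysis.Analysis"
begin

text \<open>
  The half-line is \<open>{0..} :: real set\<close>; functions on it, and on \<open>S\<close>, are total functions of
  which only the values on \<open>{0..}\<close>, respectively \<open>S\<close>, matter, and set functions on a
  \<open>\<sigma>\<close>-algebra are total functions of which only the values on its members matter.
\<close>

definition set_function :: "'a set set \<Rightarrow> ('a set \<Rightarrow> real) \<Rightarrow> bool" where
  "set_function \<C> \<mu> \<longleftrightarrow> (\<forall>E\<in>\<C>. 0 \<le> \<mu> E) \<and> \<mu> {} = 0"

definition superlevel :: "'a set \<Rightarrow> ('a \<Rightarrow> real) \<Rightarrow> real \<Rightarrow> 'a set" where
  "superlevel S f \<alpha> = {s \<in> S. \<alpha> \<le> f s}"

text \<open>\<open>\<mu>\<close>-measurability of \<open>f : S \<rightarrow> [0,\<infinity>)\<close> depends only on the \<open>\<sigma>\<close>-algebra, not on \<open>\<mu>\<close>.\<close>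

definition level_measurable :: "'a set \<Rightarrow> 'a set set \<Rightarrow> ('a \<Rightarrow> real) \<Rightarrow> bool" where
  "level_measurable S \<C> f \<longleftrightarrow> (\<forall>\<alpha>\<ge>0. superlevel S f \<alpha> \<in> \<C>)"

text \<open>
  A countable partition is a countable (possibly finite) family of nonempty, pairwise disjoint
  sets covering \<open>[0,\<infinity>)\<close>, here with all members in \<open>\<E>\<close>.
\<close>

definition countable_partition :: "real set set \<Rightarrow> real set set \<Rightarrow> bool" where
  "countable_partition \<E> P \<longleftrightarrow> partition_on {0..} P \<and> countable P \<and> P \<subseteq> \<E>"

text \<open>
  A choice of tags is a function \<open>s\<close> on the members of the partition. The series over the
  partition is required to converge absolutely, so the unordered sum is the sum of the series
  in any enumeration. \<^const>\<open>refines\<close> takes the finer partition first.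
\<close>

definition has_RL_integral ::
  "real set set \<Rightarrow> (real set \<Rightarrow> real) \<Rightarrow> (real \<Rightarrow> real) \<Rightarrow> real \<Rightarrow> bool" where
  "has_RL_integral \<E> \<nu> g a \<longleftrightarrow>
    (\<forall>\<epsilon>>0. \<exists>P\<^sub>0. countable_partition \<E> P\<^sub>0 \<and>
      (\<forall>P. countable_partition \<E> P \<and> refines {0..} P P\<^sub>0 \<longrightarrow>
        (\<forall>E\<in>P. 0 < \<nu> E \<longrightarrow> bounded (g ` E)) \<and>
        (\<forall>s. (\<forall>E\<in>P. s E \<in> E) \<longrightarrow>
          (\<lambda>E. \<bar>g (s E) * \<nu> E\<bar>) summable_on P \<and>
          \<bar>(\<Sum>\<^sub>\<infinity>E\<in>P. g (s E) * \<nu> E) - a\<bar> < \<epsilon>)))"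

definition RL_integrable ::
  "real set set \<Rightarrow> (real set \<Rightarrow> real) \<Rightarrow> (real \<Rightarrow> real) \<Rightarrow> bool" where
  "RL_integrable \<E> \<nu> g \<longleftrightarrow> (\<exists>a. has_RL_integral \<E> \<nu> g a)"

definition RL_integral ::
  "real set set \<Rightarrow> (real set \<Rightarrow> real) \<Rightarrow> (real \<Rightarrow> real) \<Rightarrow> real" where
  "RL_integral \<E> \<nu> g = (THE a. has_RL_integral \<E> \<nu> g a)"

definition decumulative ::
  "'a set \<Rightarrow> ('a set \<Rightarrow> real) \<Rightarrow> 'a set \<Rightarrow> ('a \<Rightarrow> real) \<Rightarrow> real \<Rightarrow> real" where
  "decumulative S \<mu> A f \<alpha> = \<mu> (superlevel S f \<alpha> \<inter> A)"

definition gdi ::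
  "'a set \<Rightarrow> real set set \<Rightarrow> (real set \<Rightarrow> real) \<Rightarrow> ('a set \<Rightarrow> real) \<Rightarrow> 'a set \<Rightarrow> ('a \<Rightarrow> real) \<Rightarrow> real"
  where "gdi S \<E> \<nu> \<mu> A f = RL_integral \<E> \<nu> (decumulative S \<mu> A f)"

definition G_RL ::
  "'a set \<Rightarrow> 'a set set \<Rightarrow> real set set \<Rightarrow> (real set \<Rightarrow> real) \<Rightarrow> ('a set \<Rightarrow> real) \<Rightarrow> 'a set
    \<Rightarrow> ('a \<Rightarrow> real) set" where
  "G_RL S \<C> \<E> \<nu> \<mu> A =
    {f. f \<in> S \<rightarrow> {0..} \<and> level_measurable S \<C> f \<and> RL_integrable \<E> \<nu> (decumulative S \<mu> A f)}"

end

theory Submission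
  imports Defs
begin

text \<open>
  Evaluate both integrals on a common refinement of two approximating partitions, with the same
  tags: there the sums compare termwise, because \<open>\<nu>\<close> is nonnegative. Uniqueness of the integral
  is the case of equal integrands, applied in both directions.
\<close>

lemma countable_partition_common_refinement:
  assumes "Int_stable \<E>" and "countable_partition \<E> P" and "countable_partition \<E> Q"
  shows "countable_partition \<E> (common_refinement {P, Q})"
proof -
  \<comment> \<open>An inclusion, not an equality: \<open>common_refinement\<close> discards the
    empty intersections. It transfers both countability and membership in \<open>\<E>\<close> from
    the products \<open>P \<times> Q\<close>.\<close>
  have sub: "common_refinement {P, Q} \<subseteq> (\<lambda>(X, Y). X \<inter> Y) ` (P \<times> Q)"
    by (auto simp: common_refinement)
  have "countable (common_refinement {P, Q})"
    using assms(2,3) by (intro countable_subset[OF sub]) (auto simp: countable_partition_def)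
  moreover have "common_refinement {P, Q} \<subseteq> \<E>"
    using assms by (intro order_trans[OF sub]) (auto simp: countable_partition_def Int_stable_def)
  moreover have "partition_on {0..} (common_refinement {P, Q})"
    using assms(2,3) by (intro partition_on_common_refinement) (auto simp: countable_partition_def)
  ultimately show ?thesis
    by (simp add: countable_partition_def)
qed

text \<open>Frees the refinement \<open>R\<close> and the tags \<open>s\<close> at a fixed
  precision, so that the estimates for two integrands can be instantiated at the same
  \<open>R\<close> and \<open>s\<close>.\<close>

lemma has_RL_integralE:
  assumes "has_RL_integral \<E> \<nu> g a" and "0 < e"
  obtains P where "countable_partition \<E> P"
    and "\<And>R s. \<lbrakk>countable_partition \<E> R; refines {0..} R P; \<forall>E\<in>R. s E \<in> E\<rbrakk> \<Longrightarrow>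
      (\<lambda>E. \<bar>g (s E) * \<nu> E\<bar>) summable_on R \<and> \<bar>(\<Sum>\<^sub>\<infinity>E\<in>R. g (s E) * \<nu> E) - a\<bar> < e"
  by (insert assms(1)[unfolded has_RL_integral_def, rule_format, OF assms(2)], elim exE conjE,
    rule that, assumption, simp)

text \<open>Phrased with the relation rather than with \<open>RL_integral\<close>, because
  uniqueness, which gives the definite description its value, is itself derived from it.\<close>

lemma has_RL_integral_mono:
  assumes "Int_stable \<E>" and "set_function \<E> \<nu>"
    and "has_RL_integral \<E> \<nu> g a" and "has_RL_integral \<E> \<nu> h b"
    and le: "\<And>x. 0 \<le> x \<Longrightarrow> g x \<le> h x"
  shows "a \<le> b"
proof (rule field_le_epsilon)
  fix e :: real
  assume "0 < e"
  then have e: "0 < e / 2" by simp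
  obtain P where P: "countable_partition \<E> P"
    and g: "\<And>R s. \<lbrakk>countable_partition \<E> R; refines {0..} R P; \<forall>E\<in>R. s E \<in> E\<rbrakk> \<Longrightarrow>
      (\<lambda>E. \<bar>g (s E) * \<nu> E\<bar>) summable_on R \<and> \<bar>(\<Sum>\<^sub>\<infinity>E\<in>R. g (s E) * \<nu> E) - a\<bar> < e / 2"
    by (rule has_RL_integralE[OF assms(3) e], rule that, assumption, simp)
  obtain Q where Q: "countable_partition \<E> Q"
    and h: "\<And>R s. \<lbrakk>countable_partition \<E> R; refines {0..} R Q; \<forall>E\<in>R. s E \<in> E\<rbrakk> \<Longrightarrow>
      (\<lambda>E. \<bar>h (s E) * \<nu> E\<bar>) summable_on R \<and> \<bar>(\<Sum>\<^sub>\<infinity>E\<in>R. h (s E) * \<nu> E) - b\<bar> < e / 2"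
    by (rule has_RL_integralE[OF assms(4) e], rule that, assumption, simp)
  define R where "R = common_refinement {P, Q}"
  have R: "countable_partition \<E> R"
    unfolding R_def using assms(1) P Q by (rule countable_partition_common_refinement)
  have ref: "refines {0..} R P" "refines {0..} R Q"
    unfolding R_def using P Q
    by (auto intro!: refines_common_refinement simp: countable_partition_def)
  \<comment> \<open>Any tags would do; \<open>SOME\<close> picks a genuine element because members
    of a partition are nonempty.\<close>
  define s :: "real set \<Rightarrow> real" where "s E = (SOME x. x \<in> E)" for E
  have s: "\<forall>E\<in>R. s E \<in> E"
    using R by (auto simp: s_def countable_partition_def partition_on_def some_in_eq)
  note gR = g[OF R ref(1) s] and hR = h[OF R ref(2) s]
  have "(\<Sum>\<^sub>\<infinity>E\<in>R. g (s E) * \<nu> E) \<le> (\<Sum>\<^sub>\<infinity>E\<in>R. h (s E) * \<nu> E)"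
  proof (rule infsum_mono)
    \<comment> \<open>Absolute convergence enters here: \<open>infsum\<close> defaults to 0 on a
      family that is not summable, so termwise comparison needs both series to converge.\<close>
    show "(\<lambda>E. g (s E) * \<nu> E) summable_on R" "(\<lambda>E. h (s E) * \<nu> E) summable_on R"
      by (rule abs_summable_summable, simp add: gR hR)+
    fix E
    assume "E \<in> R"
    \<comment> \<open>Members of \<open>R\<close> lie in the half-line, the only place where
      \<open>le\<close> applies, and belong to \<open>\<E>\<close>, where \<open>\<nu>\<close> is
      nonnegative.\<close>
    then have "0 \<le> s E" and "0 \<le> \<nu> E"
      using R s assms(2)
      by (auto simp: countable_partition_def partition_on_def set_function_def)
    then show "g (s E) * \<nu> E \<le> h (s E) * \<nu> E"
      by (intro mult_right_mono le)
  qed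
  \<comment> \<open>Each sum is within \<open>e / 2\<close> of its integral, so the two errors
    together cost less than \<open>e\<close>.\<close>
  with gR hR show "a \<le> b + e" by linarith
qed

lemma RL_integral_unique:
  assumes "Int_stable \<E>" and "set_function \<E> \<nu>" and "has_RL_integral \<E> \<nu> g a"
  shows "RL_integral \<E> \<nu> g = a"
proof -
  have "b = a" if "has_RL_integral \<E> \<nu> g b" for b
    using has_RL_integral_mono[OF assms(1,2) that assms(3) order_refl]
      has_RL_integral_mono[OF assms(1,2) assms(3) that order_refl] by (rule antisym)
  then show ?thesis
    unfolding RL_integral_def
    by (rule the_equality[of "has_RL_integral \<E> \<nu> g" a, OF assms(3)])
qed

lemma RL_integral_mono:
  assumes "Int_stable \<E>" and "set_function \<E> \<nu>"
    and "RL_integrable \<E> \<nu> g" and "RL_integrable \<E> \<nu> h"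
    and "\<And>x. 0 \<le> x \<Longrightarrow> g x \<le> h x"
  shows "RL_integral \<E> \<nu> g \<le> RL_integral \<E> \<nu> h"
proof -
  obtain a b where a: "has_RL_integral \<E> \<nu> g a" and b: "has_RL_integral \<E> \<nu> h b"
    using assms(3,4) unfolding RL_integrable_def by blast
  show ?thesis
    unfolding RL_integral_unique[OF assms(1,2) a] RL_integral_unique[OF assms(1,2) b]
    using assms(1,2) a b assms(5) by (rule has_RL_integral_mono)
qed

theorem theorem3p13:
  fixes S :: "'a set" and \<C> :: "'a set set" and \<E> :: "real set set"
    and \<mu>\<^sub>1 \<mu>\<^sub>2 :: "'a set \<Rightarrow> real" and \<nu> :: "real set \<Rightarrow> real"
    and f :: "'a \<Rightarrow> real" and A :: "'a set"
  assumes "infinite S"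
    and "sigma_algebra S \<C>"
    and "sigma_algebra {0..} \<E>" and "{0} \<in> \<E>"
    and "set_function \<C> \<mu>\<^sub>1" and "set_function \<C> \<mu>\<^sub>2" and "set_function \<E> \<nu>"
    and "\<forall>E\<in>\<C>. \<mu>\<^sub>1 E \<le> \<mu>\<^sub>2 E"
    and "f \<in> S \<rightarrow> {0..}" and "level_measurable S \<C> f"
    and "A \<in> \<C>"
    and "f \<in> G_RL S \<C> \<E> \<nu> \<mu>\<^sub>1 A" and "f \<in> G_RL S \<C> \<E> \<nu> \<mu>\<^sub>2 A"
  shows "gdi S \<E> \<nu> \<mu>\<^sub>1 A f \<le> gdi S \<E> \<nu> \<mu>\<^sub>2 A f"
proof -
  interpret C: sigma_algebra S \<C> by fact
  interpret E: sigma_algebra "{0..}" \<E> by fact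
  \<comment> \<open>Both sides measure the same set, a superlevel set cut with \<open>A\<close>. It
    lies in \<open>\<C>\<close> for \<alpha> \<ge> 0, so the setwise inequality applies to
    it.\<close>
  have "decumulative S \<mu>\<^sub>1 A f \<alpha> \<le> decumulative S \<mu>\<^sub>2 A f \<alpha>" if "0 \<le> \<alpha>" for \<alpha>
    using that assms(8,10,11) by (simp add: decumulative_def level_measurable_def C.Int)
  then show ?thesis
    unfolding gdi_def using assms(7,12,13)
    by (intro RL_integral_mono) (auto simp: G_RL_def Int_stable_def)
qed

end
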